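(* Let $\omega\ge 1$ and $n_0$ be natural numbers and let $(a_n)_{n\ge n_0}$ be a sequence of real numbers that is $Z(2\omega-1)$-monotonously decreasing for $n\ge n_0$, and suppose $\lim_{n\to+\infty}a_n=0$. Then the series $\sum_{n=n_0}^{\infty}(-1)^n a_n$ converges. Moreover, writing $S=\sum_{n=n_0}^{\infty}(-1)^n a_n$, $S_m=\sum_{n=n_0}^{m}(-1)^n a_n$ and $R_m=S-S_m$ for integers $m\ge n_0$, one has $$|R_m|\le \sum_{n=m+1}^{m+2\omega}|a_n|.$$
   Context: For a natural number $p$, a real sequence $\{a_n\}$ is called $Z(p)$-monotonously decreasing on a set $\mathfrak{D}$ of indices if $a_{k+p}\le a_k$ for every $k\in\mathfrak{D}$. "For $n\ge n_0$" means that $\mathfrak{D}=\{n\in\mathbb{N}: n\ge n_0\}$. *)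

theory Defs
  imports Complex_Main
begin

definition Z_decreasing_on :: "nat \<Rightarrow> nat set \<Rightarrow> (nat \<Rightarrow> real) \<Rightarrow> bool" where
  "Z_decreasing_on p D a \<longleftrightarrow> (\<forall>k\<in>D. a (k + p) \<le> a k)"

end

(* Put p = 2 \<omega> - 1 and d k = (-1)^k a k.  As p is odd, d k + d (k + p) = (-1)^k (a k - a (k + p)), whose
   absolute value a k - a (k + p) telescopes; d k - d (k + p) telescopes as well.  Half the sum of
   these two convergent series is the alternating series, and each of them is bounded by the sum of
   |a k| over the first p indices. *)
theory Submission
  imports Defs
begin

text \<open>Induction on \<open>p\<close>: passing from \<open>p\<close> to \<open>Suc p\<close>
  adds the ordinary telescoping series of \<open>f\<close> started at index \<open>p\<close>, which
  sums to \<open>f p\<close> because \<open>f\<close> tends to 0.\<close>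

lemma telescope_sums_shift:
  fixes f :: "nat \<Rightarrow> 'a::real_normed_vector"
  assumes "f \<longlonglongrightarrow> 0"
  shows "(\<lambda>k. f k - f (k + p)) sums (\<Sum>k<p. f k)"
proof (induction p)
  case 0
  then show ?case by simp
next
  case (Suc p)
  have "(\<lambda>k. f (k + p)) \<longlonglongrightarrow> 0"
    using assms by (rule LIMSEQ_ignore_initial_segment)
  then have "(\<lambda>k. f (k + p) - f (Suc k + p)) sums (f (0 + p) - 0)"
    by (rule telescope_sums')
  from sums_add[OF Suc this] show ?case by simp
qed

text \<open>Stated for indices from 0 so that it fits every tail of a sequence: the full tail gives
  convergence, a later tail gives the remainder bound.\<close>

lemma alternating_sums_shift_decreasing:
  fixes c :: "nat \<Rightarrow> real"
  assumes "odd p" and decr: "\<And>k. c (k + p) \<le> c k" and "c \<longlonglongrightarrow> 0"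
  shows "summable (\<lambda>k. (-1) ^ k * c k)"
    and "\<bar>\<Sum>k. (-1) ^ k * c k\<bar> \<le> (\<Sum>k<p. \<bar>c k\<bar>)"
proof -
  define d where "d k = (-1) ^ k * c k" for k
  define e where "e k = d k + d (k + p)" for k
  have abs_d: "\<bar>d k\<bar> = \<bar>c k\<bar>" for k
    by (simp add: d_def abs_mult power_abs)
  have "d \<longlonglongrightarrow> 0"
    using \<open>c \<longlonglongrightarrow> 0\<close> by (subst tendsto_rabs_zero_iff[symmetric])
      (simp add: abs_d tendsto_rabs_zero)
  then have diff: "(\<lambda>k. d k - d (k + p)) sums (\<Sum>k<p. d k)"
    by (rule telescope_sums_shift)
  have "e k = (-1) ^ k * (c k - c (k + p))" for k
    using \<open>odd p\<close> by (simp add: e_def d_def power_add algebra_simps)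
  \<comment> \<open>By \<open>decr\<close> the difference is nonnegative, so the absolute values
    telescope too and \<open>e\<close> converges absolutely.\<close>
  then have "\<bar>e k\<bar> = c k - c (k + p)" for k
    using decr[of k] by (simp add: abs_mult power_abs)
  then have abs_e: "(\<lambda>k. \<bar>e k\<bar>) sums (\<Sum>k<p. c k)"
    using telescope_sums_shift[OF \<open>c \<longlonglongrightarrow> 0\<close>] by simp
  then have "summable e"
    using summable_rabs_cancel sums_summable by blast
  \<comment> \<open>The terms \<open>d (k + p)\<close> cancel and leave \<open>2 * d k\<close>, so
    \<open>d\<close> converges even where it does not converge absolutely.\<close>
  then have "(\<lambda>k. (e k + (d k - d (k + p))) / 2) sums ((suminf e + (\<Sum>k<p. d k)) / 2)"
    by (intro sums_divide sums_add diff summable_sums)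
  then have sums: "d sums ((suminf e + (\<Sum>k<p. d k)) / 2)"
    by (simp add: e_def)
  have "\<bar>suminf e\<bar> \<le> (\<Sum>k. \<bar>e k\<bar>)"
    using abs_e by (intro summable_rabs sums_summable)
  also have "\<dots> = (\<Sum>k<p. c k)"
    using abs_e by (simp add: sums_iff)
  also have "\<dots> \<le> (\<Sum>k<p. \<bar>c k\<bar>)"
    by (intro sum_mono abs_ge_self)
  finally have "\<bar>suminf e\<bar> \<le> (\<Sum>k<p. \<bar>c k\<bar>)" .
  moreover have "\<bar>\<Sum>k<p. d k\<bar> \<le> (\<Sum>k<p. \<bar>c k\<bar>)"
    using sum_abs[of d "{..<p}"] by (simp add: abs_d)
  \<comment> \<open>The sum of \<open>d\<close> is the mean of two numbers, each bounded in modulus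
    by the right-hand side.\<close>
  ultimately have "\<bar>suminf d\<bar> \<le> (\<Sum>k<p. \<bar>c k\<bar>)"
    unfolding sums_unique[OF sums, symmetric] abs_le_iff by argo
  with sums show "summable (\<lambda>k. (-1) ^ k * c k)"
    and "\<bar>\<Sum>k. (-1) ^ k * c k\<bar> \<le> (\<Sum>k<p. \<bar>c k\<bar>)"
    by (auto simp: d_def[abs_def] sums_iff)
qed

theorem theorem1:
  fixes \<omega> n\<^sub>0 :: nat and a :: "nat \<Rightarrow> real"
  assumes "\<omega> \<ge> 1"
    and "Z_decreasing_on (2 * \<omega> - 1) {n. n \<ge> n\<^sub>0} a"
    and "a \<longlonglongrightarrow> 0"
  shows "summable (\<lambda>k. (-1) ^ (n\<^sub>0 + k) * a (n\<^sub>0 + k)) \<and>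
    (\<forall>m\<ge>n\<^sub>0.
      \<bar>(\<Sum>k. (-1) ^ (n\<^sub>0 + k) * a (n\<^sub>0 + k)) - (\<Sum>n=n\<^sub>0..m. (-1) ^ n * a n)\<bar>
        \<le> (\<Sum>n=m+1..m+2*\<omega>. \<bar>a n\<bar>))"
proof -
  define p where "p = 2 * \<omega> - 1"
  \<comment> \<open>Subtraction on naturals truncates: \<open>\<omega> = 0\<close> would give the
    even value \<open>p = 0\<close>.\<close>
  have "odd p" and "p \<le> 2 * \<omega>"
    using \<open>\<omega> \<ge> 1\<close> by (auto simp: p_def)
  define t where "t n = (-1) ^ n * a n" for n
  \<comment> \<open>The tail from \<open>N\<close> is an alternating series starting with sign +, up
    to the constant factor \<open>(-1) ^ N\<close> of modulus 1.\<close>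
  have t_shift: "t (N + k) = (-1) ^ N * ((-1) ^ k * a (N + k))" for N k
    by (simp add: t_def power_add)
  \<comment> \<open>Used with \<open>N = n\<^sub>0\<close> for convergence and with
    \<open>N = m + 1\<close> for the remainder.\<close>
  have tail: "summable (\<lambda>k. t (N + k))" "\<bar>\<Sum>k. t (N + k)\<bar> \<le> (\<Sum>k<p. \<bar>a (N + k)\<bar>)"
    if "N \<ge> n\<^sub>0" for N
  proof -
    have "a (N + (k + p)) \<le> a (N + k)" for k
      using assms(2) that by (auto simp: Z_decreasing_on_def p_def add.assoc[symmetric])
    moreover have "(\<lambda>k. a (N + k)) \<longlonglongrightarrow> 0"
      using LIMSEQ_ignore_initial_segment[OF \<open>a \<longlonglongrightarrow> 0\<close>, of N] by (simp add: add.commute)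
    ultimately have *: "summable (\<lambda>k. (-1) ^ k * a (N + k))"
        "\<bar>\<Sum>k. (-1) ^ k * a (N + k)\<bar> \<le> (\<Sum>k<p. \<bar>a (N + k)\<bar>)"
      using alternating_sums_shift_decreasing[OF \<open>odd p\<close>, of "\<lambda>k. a (N + k)"] by auto
    from *(1) show "summable (\<lambda>k. t (N + k))"
      unfolding t_shift by (rule summable_mult)
    from * show "\<bar>\<Sum>k. t (N + k)\<bar> \<le> (\<Sum>k<p. \<bar>a (N + k)\<bar>)"
      unfolding t_shift by (subst suminf_mult) (simp_all add: abs_mult power_abs)
  qed
  have "\<bar>(\<Sum>k. t (n\<^sub>0 + k)) - (\<Sum>n=n\<^sub>0..m. t n)\<bar> \<le> (\<Sum>n=m+1..m+2*\<omega>. \<bar>a n\<bar>)"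
    if "m \<ge> n\<^sub>0" for m
  proof -
    \<comment> \<open>The number of terms in the partial sum up to \<open>m\<close>; removing them
      leaves the tail that starts at \<open>m + 1\<close>.\<close>
    define q where "q = m + 1 - n\<^sub>0"
    have q: "n\<^sub>0 + q = m + 1"
      using that by (simp add: q_def)
    have "(\<Sum>n=n\<^sub>0..m. t n) = (\<Sum>k<q. t (n\<^sub>0 + k))"
      using that by (intro sum.reindex_bij_witness[of _ "\<lambda>k. n\<^sub>0 + k" "\<lambda>n. n - n\<^sub>0"])
        (auto simp: q_def)
    then have "(\<Sum>k. t (n\<^sub>0 + k)) - (\<Sum>n=n\<^sub>0..m. t n) = (\<Sum>k. t (n\<^sub>0 + (k + q)))"
      using suminf_split_initial_segment[OF tail(1)[OF order_refl], of q] by simp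
    also have "\<dots> = (\<Sum>k. t (m + 1 + k))"
      by (metis q add.assoc add.commute)
    finally have "\<bar>(\<Sum>k. t (n\<^sub>0 + k)) - (\<Sum>n=n\<^sub>0..m. t n)\<bar> \<le> (\<Sum>k<p. \<bar>a (m + 1 + k)\<bar>)"
      using tail(2)[of "m + 1"] that by simp
    \<comment> \<open>The tail bound has \<open>2 * \<omega> - 1\<close> terms; the stated sum has
      one more, the nonnegative \<open>\<bar>a (m + 2 * \<omega>)\<bar>\<close>.\<close>
    also have "\<dots> \<le> (\<Sum>k<2*\<omega>. \<bar>a (m + 1 + k)\<bar>)"
      using \<open>p \<le> 2 * \<omega>\<close> by (intro sum_mono2) auto
    also have "\<dots> = (\<Sum>n=m+1..m+2*\<omega>. \<bar>a n\<bar>)"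
      by (intro sum.reindex_bij_witness[of _ "\<lambda>n. n - (m + 1)" "\<lambda>k. m + 1 + k"]) auto
    finally show ?thesis .
  qed
  with tail(1)[OF order_refl] show ?thesis
    by (simp add: t_def)
qed

end
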